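(* Let $H=(Q^0,Q^1,\delta^0,\delta^1,q_0)$ be a two-player game graph, $Q=Q^0\cup Q^1$, and let $F_{\mathcal A},F_{\mathcal G}\subseteq Q$, $\mathcal F_{\mathcal A}=\{F_{\mathcal A}\}$, $\mathcal F_{\mathcal G}=\{F_{\mathcal G}\}$. Let $Z^\infty=[\![\varphi_4]\!]$ where $$\varphi_4=\nu Z.\,\mu Y.\,\nu X.\,\mu W.\;\big(F_{\mathcal G}\cap \mathrm{Pre}^1(Z)\big)\cup \mathrm{Pre}^1(Y)\cup\big((Q\setminus F_{\mathcal A})\cap \mathrm{CPre}(W,\,X\setminus F_{\mathcal A})\big),$$ and let $\mathrm{rank}:Z^\infty\to\mathbb N^2$ be the ranking defined below. Let $f^1$ be a memoryless system strategy such that for every $q\in Q^1\cap Z^\infty$, $q'=f^1(q)$ satisfies $q'\in\delta^1(q)$ and: $q'\in Z^\infty$ with $\mathrm{rank}(q')<\mathrm{rank}(q)$ if $\mathrm{rank}(q)>(1,1)$, and $q'\in Z^\infty$ otherwise. Then for all $q\in Z^\infty$: (a) $\mathcal L_q(H,f^1)\subseteq \overline{\mathcal L_q(H,\mathcal F_{\mathcal A})}\cup \mathcal L_q(H,\mathcal F_{\mathcal G})$; (b) $\mathcal L_q(H,f^1)\cap\mathcal L_q(H,\mathcal F_{\mathcal G})\neq\emptyset$; (c) if $\mathcal L_q(H,\mathcal F_{\mathcal G})\subseteq\mathcal L_q(H,\mathcal F_{\mathcal A})$, then $\mathrm{pre}(\mathcal L_q(H,f^1))=\mathrm{pre}\big(\mathcal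 L_q(H,f^1)\cap \mathcal L_q(H,\mathcal F_{\mathcal A})\big)$.
   Context: A two-player game graph $H=(Q^0,Q^1,\delta^0,\delta^1,q_0)$ has finite disjoint state sets $Q^0$ (environment, player 0) and $Q^1$ (system, player 1), transition functions $\delta^0:Q^0\to 2^{Q^1}$, $\delta^1:Q^1\to 2^{Q^0}$, and $q_0\in Q^0$. For $q\in Q$, a play from $q$ is an infinite state sequence $\pi$ with $\pi(0)=q$ and $\pi(k+1)\in\delta^0(\pi(k))$ if $\pi(k)\in Q^0$, $\pi(k+1)\in\delta^1(\pi(k))$ if $\pi(k)\in Q^1$. A system strategy maps finite play prefixes ending in $Q^1$ to states in $Q^0$; it is memoryless if it depends only on the last state. $\mathcal L_q(H,f^1)$ is the set of plays from $q$ in which every move from a $Q^1$-state is the one given by $f^1$. For a family $\mathcal F$ of subsets of $Q$, $\mathcal L_q(H,\mathcal F)$ is the set of plays from $q$ visiting every set in $\mathcal F$ infinitely often; $\overline{\mathcal L}$ denotes complement within the set of all infinite state sequences, and $\mathrm{pre}(\mathcal L)$ is the set of all finite prefixes of words in $\mathcal L$. For $P,P'\subseteq Q$: $\mathrm{Pre}^{\exists}(P)=\{q\in Q^0:\delta^0(q)\cap P\neq\emptyset\}\cup\{q\in Q^1:\delta^1(q)\cap P\neq\emptyset\}$; $\mathrm{Pre}^1(P)=\{q\in Q^0:\delta^0(q)\subseteq P\}\cup\{q\in Q^1:\delta^1(q)\cap P\neq\emptyset\}$; $\mathrm{CPre}(P,P')=\mathrm{Pre}^{\exists}(P)\cap\mathrm{Pre}^1(P\cup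 P')$. $\mu,\nu$ denote least and greatest fixpoints (modal $\mu$-calculus over subsets of $Q$). Ranking: let $\Phi(Y,X,W)=(F_{\mathcal G}\cap\mathrm{Pre}^1(Z^\infty))\cup\mathrm{Pre}^1(Y)\cup((Q\setminus F_{\mathcal A})\cap\mathrm{CPre}(W,X\setminus F_{\mathcal A}))$ (the body with $Z:=Z^\infty$). Set $Y^0=\emptyset$ and for $i\ge1$, $Y^i=\nu X.\mu W.\Phi(Y^{i-1},X,W)$ (so $Y^i$ is the $i$-th iterate of $\mu Y$ in the last iteration of $Z$, and $Y^k=Z^\infty$ for some $k$). For $i\ge1$ let $W^i_0=\emptyset$ and $W^i_j=\Phi(Y^{i-1},Y^i,W^i_{j-1})$ for $j\ge1$. For $q\in Z^\infty$ and $i,j>0$, $\mathrm{rank}(q)=(i,j)$ iff $q\in(Y^i\setminus Y^{i-1})\cap(W^i_j\setminus W^i_{j-1})$. Ranks are ordered lexicographically.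
   Formalization: Parts (b) and (c) are stated under the extra assumption that every environment state has a successor; an environment state with none lies in Z^∞ but starts no infinite play, so (b) fails there. Part (a) needs no such assumption. *)

theory Defs
  imports Main
begin

record 'q game_graph =
  env_states :: "'q set"
  sys_states :: "'q set"
  env_trans :: "'q \<Rightarrow> 'q set"
  sys_trans :: "'q \<Rightarrow> 'q set"
  init_state :: 'q

definition states :: "'q game_graph \<Rightarrow> 'q set" where
  "states H = env_states H \<union> sys_states H"

definition game_graph :: "'q game_graph \<Rightarrow> bool" where
  "game_graph H \<longleftrightarrow>
     finite (env_states H) \<and> finite (sys_states H) \<and>
     env_states H \<inter> sys_states H = {} \<and>
     (\<forall>q\<in>env_states H. env_trans H q \<subseteq> sys_states H) \<and>
     (\<forall>q\<in>sys_states H. sys_trans H q \<subseteq> env_states H) \<and>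
     init_state H \<in> env_states H"

text \<open>
  Environment dead ends trivially belong to \<open>Pre_sys H {}\<close> below, although no infinite play
  starts there; existence claims about plays therefore need this condition.
\<close>

definition env_nonblocking :: "'q game_graph \<Rightarrow> bool" where
  "env_nonblocking H \<longleftrightarrow> (\<forall>q\<in>env_states H. env_trans H q \<noteq> {})"

definition move :: "'q game_graph \<Rightarrow> 'q \<Rightarrow> 'q \<Rightarrow> bool" where
  "move H q q' \<longleftrightarrow>
     (q \<in> env_states H \<and> q' \<in> env_trans H q) \<or> (q \<in> sys_states H \<and> q' \<in> sys_trans H q)"

definition state_sequences :: "'q game_graph \<Rightarrow> (nat \<Rightarrow> 'q) set" where
  "state_sequences H = {\<pi>. \<forall>k. \<pi> k \<in> states H}"

definition plays :: "'q game_graph \<Rightarrow> 'q \<Rightarrow> (nat \<Rightarrow> 'q) set" where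
  "plays H q = {\<pi> \<in> state_sequences H. \<pi> 0 = q \<and> (\<forall>k. move H (\<pi> k) (\<pi> (Suc k)))}"

text \<open>
  The histories on which a system strategy is defined: finite paths, from an arbitrary state,
  that end in a system state. In particular a single system state is such a history.
\<close>

definition sys_histories :: "'q game_graph \<Rightarrow> 'q list set" where
  "sys_histories H =
     {\<rho>. \<rho> \<noteq> [] \<and> set \<rho> \<subseteq> states H \<and> last \<rho> \<in> sys_states H \<and>
        (\<forall>k. Suc k < length \<rho> \<longrightarrow> move H (\<rho> ! k) (\<rho> ! Suc k))}"

definition sys_strategy :: "'q game_graph \<Rightarrow> ('q list \<Rightarrow> 'q) \<Rightarrow> bool" where
  "sys_strategy H f \<longleftrightarrow> (\<forall>\<rho>\<in>sys_histories H. f \<rho> \<in> env_states H)"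

text \<open>The value of a memoryless strategy at a system state \<open>q\<close> is \<open>f [q]\<close>.\<close>

definition memoryless :: "'q game_graph \<Rightarrow> ('q list \<Rightarrow> 'q) \<Rightarrow> bool" where
  "memoryless H f \<longleftrightarrow>
     (\<forall>\<rho>\<in>sys_histories H. \<forall>\<rho>'\<in>sys_histories H. last \<rho> = last \<rho>' \<longrightarrow> f \<rho> = f \<rho>')"

definition prefix_of :: "(nat \<Rightarrow> 'q) \<Rightarrow> nat \<Rightarrow> 'q list" where
  "prefix_of \<pi> n = map \<pi> [0..<n]"

definition pre :: "(nat \<Rightarrow> 'q) set \<Rightarrow> 'q list set" where
  "pre L = {prefix_of \<pi> n |\<pi> n. \<pi> \<in> L}"

definition strategy_plays :: "'q game_graph \<Rightarrow> ('q list \<Rightarrow> 'q) \<Rightarrow> 'q \<Rightarrow> (nat \<Rightarrow> 'q) set" where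
  "strategy_plays H f q =
     {\<pi> \<in> plays H q. \<forall>k. \<pi> k \<in> sys_states H \<longrightarrow> \<pi> (Suc k) = f (prefix_of \<pi> (Suc k))}"

definition buechi_plays :: "'q game_graph \<Rightarrow> 'q set set \<Rightarrow> 'q \<Rightarrow> (nat \<Rightarrow> 'q) set" where
  "buechi_plays H \<F> q = {\<pi> \<in> plays H q. \<forall>F\<in>\<F>. infinite {k. \<pi> k \<in> F}}"

definition Pre_ex :: "'q game_graph \<Rightarrow> 'q set \<Rightarrow> 'q set" where
  "Pre_ex H P =
     {q \<in> env_states H. env_trans H q \<inter> P \<noteq> {}} \<union> {q \<in> sys_states H. sys_trans H q \<inter> P \<noteq> {}}"

definition Pre_sys :: "'q game_graph \<Rightarrow> 'q set \<Rightarrow> 'q set" where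
  "Pre_sys H P =
     {q \<in> env_states H. env_trans H q \<subseteq> P} \<union> {q \<in> sys_states H. sys_trans H q \<inter> P \<noteq> {}}"

definition CPre :: "'q game_graph \<Rightarrow> 'q set \<Rightarrow> 'q set \<Rightarrow> 'q set" where
  "CPre H P P' = Pre_ex H P \<inter> Pre_sys H (P \<union> P')"

definition body ::
  "'q game_graph \<Rightarrow> 'q set \<Rightarrow> 'q set \<Rightarrow> 'q set \<Rightarrow> 'q set \<Rightarrow> 'q set \<Rightarrow> 'q set \<Rightarrow> 'q set" where
  "body H FA FG Z Y X W =
     (FG \<inter> Pre_sys H Z) \<union> Pre_sys H Y \<union> ((states H - FA) \<inter> CPre H W (X - FA))"

text \<open>
  The body only takes values below \<open>states H\<close>, so the fixpoints in the lattice of all sets over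
  the type coincide with those in the lattice of subsets of \<open>states H\<close>.
\<close>

definition Z_inf :: "'q game_graph \<Rightarrow> 'q set \<Rightarrow> 'q set \<Rightarrow> 'q set" where
  "Z_inf H FA FG = gfp (\<lambda>Z. lfp (\<lambda>Y. gfp (\<lambda>X. lfp (\<lambda>W. body H FA FG Z Y X W))))"

definition \<Phi> ::
  "'q game_graph \<Rightarrow> 'q set \<Rightarrow> 'q set \<Rightarrow> 'q set \<Rightarrow> 'q set \<Rightarrow> 'q set \<Rightarrow> 'q set" where
  "\<Phi> H FA FG Y X W = body H FA FG (Z_inf H FA FG) Y X W"

fun Y_iter :: "'q game_graph \<Rightarrow> 'q set \<Rightarrow> 'q set \<Rightarrow> nat \<Rightarrow> 'q set" where
  "Y_iter H FA FG 0 = {}"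
| "Y_iter H FA FG (Suc i) = gfp (\<lambda>X. lfp (\<lambda>W. \<Phi> H FA FG (Y_iter H FA FG i) X W))"

text \<open>Only meaningful for \<open>i \<ge> 1\<close>.\<close>

fun W_iter :: "'q game_graph \<Rightarrow> 'q set \<Rightarrow> 'q set \<Rightarrow> nat \<Rightarrow> nat \<Rightarrow> 'q set" where
  "W_iter H FA FG i 0 = {}"
| "W_iter H FA FG i (Suc j) =
     \<Phi> H FA FG (Y_iter H FA FG (i - 1)) (Y_iter H FA FG i) (W_iter H FA FG i j)"

definition has_rank :: "'q game_graph \<Rightarrow> 'q set \<Rightarrow> 'q set \<Rightarrow> 'q \<Rightarrow> nat \<times> nat \<Rightarrow> bool" where
  "has_rank H FA FG q r \<longleftrightarrow>
     (case r of (i, j) \<Rightarrow> i > 0 \<and> j > 0 \<and>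
        q \<in> (Y_iter H FA FG i - Y_iter H FA FG (i - 1)) \<inter>
            (W_iter H FA FG i j - W_iter H FA FG i (j - 1)))"

text \<open>Every state of \<open>Z_inf H FA FG\<close> has exactly one rank; elsewhere the value is irrelevant.\<close>

definition rank :: "'q game_graph \<Rightarrow> 'q set \<Rightarrow> 'q set \<Rightarrow> 'q \<Rightarrow> nat \<times> nat" where
  "rank H FA FG q = (THE r. has_rank H FA FG q r)"

definition rank_less :: "nat \<times> nat \<Rightarrow> nat \<times> nat \<Rightarrow> bool" where
  "rank_less r s \<longleftrightarrow> (r, s) \<in> less_than <*lex*> less_than"

end

theory Submission
  imports Defs
begin

text \<open>
  Under \<open>f\<close> and outside \<open>FG\<close> the first rank component never increases, and it strictly decreases
  at states of rank \<open>(i, 1)\<close>, while states of rank \<open>(i, j)\<close> with \<open>j > 1\<close> avoid \<open>FA\<close>. Hence a play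
  that eventually avoids \<open>FG\<close> eventually avoids \<open>FA\<close>. Conversely, if the environment cooperates by
  decreasing the rank whenever it can, rank \<open>(1, 1)\<close>, and thereby \<open>FG\<close>, is reached again and again.
  Such a cooperative continuation exists after every finite prefix, which gives (b) and (c).
\<close>

section \<open>Kleene iteration\<close>

lemma finite_lfp_Kleene_iter:
  fixes F :: "'a set \<Rightarrow> 'a set"
  assumes "mono F" "finite (lfp F)"
  shows "\<exists>k. (F ^^ k) {} = lfp F"
proof -
  have below: "(F ^^ n) {} \<subseteq> lfp F" for n
    by (rule Kleene_iter_lpfp[OF assms(1)]) (simp_all add: lfp_fixpoint[OF assms(1)])
  have inc: "(F ^^ n) {} \<subseteq> (F ^^ Suc n) {}" for n
    using funpow_decreasing[of n "Suc n" F] assms(1) by simp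
  have "\<exists>k. (F ^^ Suc k) {} = (F ^^ k) {}"
  proof (rule ccontr)
    assume "\<not> ?thesis"
    then have strict: "(F ^^ n) {} \<subset> (F ^^ Suc n) {}" for n
      using inc[of n] by blast
    have "n \<le> card ((F ^^ n) {})" for n
    proof (induction n)
      case (Suc n)
      have "card ((F ^^ n) {}) < card ((F ^^ Suc n) {})"
        by (intro psubset_card_mono strict finite_subset[OF below assms(2)])
      with Suc show ?case by linarith
    qed simp
    moreover have "card ((F ^^ n) {}) \<le> card (lfp F)" for n
      by (rule card_mono[OF assms(2) below])
    ultimately show False
      using not_less_eq_eq order_trans by blast
  qed
  then obtain k where "(F ^^ Suc k) {} = (F ^^ k) {}" ..
  then have "lfp F = (F ^^ k) {}"
    using lfp_Kleene_iter[OF assms(1)] by simp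
  then show ?thesis by auto
qed

section \<open>Ranks\<close>

lemma Pre_sys_mono: "P \<subseteq> P' \<Longrightarrow> Pre_sys H P \<subseteq> Pre_sys H P'"
  by (auto simp: Pre_sys_def)

lemma Pre_ex_mono: "P \<subseteq> P' \<Longrightarrow> Pre_ex H P \<subseteq> Pre_ex H P'"
  by (auto simp: Pre_ex_def)

lemma CPre_mono: "P \<subseteq> Q \<Longrightarrow> P' \<subseteq> Q' \<Longrightarrow> CPre H P P' \<subseteq> CPre H Q Q'"
  unfolding CPre_def by (intro Int_mono Pre_sys_mono Pre_ex_mono Un_mono)

lemma body_mono:
  assumes "Z \<subseteq> Z'" "Y \<subseteq> Y'" "X \<subseteq> X'" "W \<subseteq> W'"
  shows "body H FA FG Z Y X W \<subseteq> body H FA FG Z' Y' X' W'"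
  unfolding body_def
  by (intro Un_mono Int_mono Pre_sys_mono CPre_mono Diff_mono order_refl assms)

lemma body_subset_states: "body H FA FG Z Y X W \<subseteq> states H"
  by (auto simp: body_def Pre_sys_def states_def)

declare Y_iter.simps(2) [simp del] W_iter.simps(2) [simp del]

locale ranked_game =
  fixes H :: "'q game_graph" and FA FG :: "'q set"
  assumes game: "game_graph H"
begin

abbreviation "Z \<equiv> Z_inf H FA FG"
abbreviation "Y \<equiv> Y_iter H FA FG"
abbreviation "W \<equiv> W_iter H FA FG"
abbreviation "rk \<equiv> rank H FA FG"

abbreviation "XW A B \<equiv> gfp (\<lambda>C. lfp (body H FA FG A B C))"

lemma XW_mono: "A \<subseteq> A' \<Longrightarrow> B \<subseteq> B' \<Longrightarrow> XW A B \<subseteq> XW A' B'"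
  by (intro gfp_mono lfp_mono body_mono order_refl)

lemma Z_eq_lfp: "Z = lfp (XW Z)"
proof -
  have "mono (\<lambda>A. lfp (XW A))"
    by (intro monoI lfp_mono XW_mono order_refl)
  then show ?thesis
    unfolding Z_inf_def by (rule gfp_unfold)
qed

lemma mono_XW: "mono (XW Z)"
  by (intro monoI XW_mono order_refl)

lemma Y_eq_funpow: "Y i = (XW Z ^^ i) {}"
  by (induction i) (simp_all add: Y_iter.simps(2) \<Phi>_def[abs_def])

lemma mono_\<Phi>: "mono (\<Phi> H FA FG V X)"
  unfolding \<Phi>_def by (intro monoI body_mono order_refl)

lemma Y_Suc_eq_lfp: "Y (Suc i) = lfp (\<Phi> H FA FG (Y i) (Y (Suc i)))"
proof -
  have "mono (\<lambda>X. lfp (\<Phi> H FA FG (Y i) X))"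
    unfolding \<Phi>_def by (intro monoI lfp_mono body_mono order_refl)
  from gfp_unfold[OF this] show ?thesis by (simp add: Y_iter.simps(2))
qed

lemma W_Suc_eq_funpow: "W (Suc i) j = (\<Phi> H FA FG (Y i) (Y (Suc i)) ^^ j) {}"
  by (induction j) (simp_all add: W_iter.simps(2))

lemma Y_subset_states: "Y i \<subseteq> states H"
proof (cases i)
  case (Suc n)
  have "Y (Suc n) \<subseteq> states H"
    by (subst Y_Suc_eq_lfp, rule lfp_lowerbound) (simp add: \<Phi>_def body_subset_states)
  then show ?thesis using Suc by simp
qed simp

lemma finite_states: "finite (states H)"
  using game by (simp add: game_graph_def states_def)

lemma Z_subset_states: "Z \<subseteq> states H"
proof -
  have "XW Z (states H) \<subseteq> states H"
  proof (rule gfp_least)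
    fix C assume "C \<subseteq> lfp (body H FA FG Z (states H) C)"
    also have "\<dots> \<subseteq> states H"
      by (rule lfp_lowerbound[OF body_subset_states])
    finally show "C \<subseteq> states H" .
  qed
  then show ?thesis
    by (subst Z_eq_lfp) (rule lfp_lowerbound)
qed

lemma Y_mono: "i \<le> i' \<Longrightarrow> Y i \<subseteq> Y i'"
  unfolding Y_eq_funpow using funpow_decreasing[OF _ mono_XW] by simp

lemma Y_subset_Z: "Y i \<subseteq> Z"
proof -
  have "XW Z Z = Z"
    using lfp_fixpoint[OF mono_XW] by (simp flip: Z_eq_lfp)
  then show ?thesis
    unfolding Y_eq_funpow by (intro Kleene_iter_lpfp[OF mono_XW]) simp
qed

lemma Z_eq_Y: "\<exists>k. Z = Y k"
  using finite_lfp_Kleene_iter[OF mono_XW] Z_eq_lfp Z_subset_states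
  by (metis Y_eq_funpow finite_states finite_subset)

lemma W_mono: "j \<le> j' \<Longrightarrow> W (Suc i) j \<subseteq> W (Suc i) j'"
  unfolding W_Suc_eq_funpow using funpow_decreasing[OF _ mono_\<Phi>] by simp

lemma Y_Suc_eq_W: "\<exists>k. Y (Suc i) = W (Suc i) k"
  using finite_lfp_Kleene_iter[OF mono_\<Phi>] Y_Suc_eq_lfp[of i] Y_subset_states[of "Suc i"]
  by (metis W_Suc_eq_funpow finite_states finite_subset)

lemma rank_eqI:
  assumes q: "q \<in> Y (Suc i)" "q \<notin> Y i" "q \<in> W (Suc i) (Suc j)" "q \<notin> W (Suc i) j"
  shows "rk q = (Suc i, Suc j)"
  unfolding rank_def
proof (rule the_equality)
  show "has_rank H FA FG q (Suc i, Suc j)"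
    using q by (simp add: has_rank_def)
next
  fix r assume r: "has_rank H FA FG q r"
  then obtain i' j' where r_eq: "r = (Suc i', Suc j')"
    by (cases r; cases "fst r"; cases "snd r")
      (auto simp: has_rank_def)
  with r have r': "q \<in> Y (Suc i')" "q \<notin> Y i'" "q \<in> W (Suc i') (Suc j')" "q \<notin> W (Suc i') j'"
    by (simp_all add: has_rank_def)
  have "\<not> i < i'" "\<not> i' < i"
    using q(1,2) r'(1,2) Y_mono[of "Suc i" i'] Y_mono[of "Suc i'" i] by auto
  then have "i' = i" by simp
  moreover have "\<not> j < j'" "\<not> j' < j"
    using q(3,4) r'(3,4) W_mono[of "Suc j" j' i] W_mono[of "Suc j'" j i] \<open>i' = i\<close> by auto
  then have "j' = j" by simp
  ultimately show "r = (Suc i, Suc j)"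
    by (simp add: r_eq)
qed

lemma rank_exists:
  assumes "q \<in> Z"
  obtains i j where "rk q = (Suc i, Suc j)"
    "q \<in> Y (Suc i)" "q \<notin> Y i" "q \<in> W (Suc i) (Suc j)" "q \<notin> W (Suc i) j"
proof -
  from assms Z_eq_Y obtain k where "q \<in> Y k" by blast
  then obtain i where i: "q \<in> Y (Suc i)" "q \<notin> Y i"
    using ex_least_nat_less[of "\<lambda>n. q \<in> Y n" k] by auto
  from i(1) Y_Suc_eq_W[of i] obtain l where "q \<in> W (Suc i) l" by blast
  then obtain j where j: "q \<in> W (Suc i) (Suc j)" "q \<notin> W (Suc i) j"
    using ex_least_nat_less[of "\<lambda>n. q \<in> W (Suc i) n" l] by auto
  show thesis
    by (rule that[OF rank_eqI[OF i j] i j])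
qed

lemma fst_rank_le:
  assumes "q \<in> Y i"
  shows "fst (rk q) \<le> i"
proof -
  obtain i' where "fst (rk q) = Suc i'" "q \<notin> Y i'"
    using assms Y_subset_Z rank_exists by (metis fst_conv subsetD)
  then show ?thesis
    using assms Y_mono[of i i'] by (metis not_less_eq_eq subsetD)
qed

lemma rank_less_W:
  assumes "q \<in> W (Suc i) j"
  shows "rank_less (rk q) (Suc i, Suc j)" and "q \<in> Y (Suc i)"
proof -
  show Y: "q \<in> Y (Suc i)"
  proof -
    have "W (Suc i) j \<subseteq> lfp (\<Phi> H FA FG (Y i) (Y (Suc i)))"
      unfolding W_Suc_eq_funpow
      using Kleene_iter_lpfp[OF mono_\<Phi>] lfp_fixpoint[OF mono_\<Phi>] by (metis order_refl)
    then show ?thesis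
      using assms Y_Suc_eq_lfp by blast
  qed
  then obtain i' j' where r: "rk q = (Suc i', Suc j')" "q \<notin> W (Suc i') j'"
    using Y_subset_Z rank_exists by (metis subsetD)
  show "rank_less (rk q) (Suc i, Suc j)"
  proof (cases "i' = i")
    case True
    then have "j' < j"
      using assms r W_mono[of j j' i] by (metis not_less subsetD)
    then show ?thesis using True r by (simp add: rank_less_def)
  next
    case False
    then show ?thesis
      using fst_rank_le[OF Y] r by (simp add: rank_less_def)
  qed
qed

lemma rank_cases:
  assumes "q \<in> Z"
  obtains (recurrent) "rk q = (1, 1)" "q \<in> FG" "q \<in> Pre_sys H Z"
  | (progress) i where "rk q = (Suc i, 1)" "q \<in> Pre_sys H (Y i)"
  | (avoid) i j where "rk q = (Suc i, Suc (Suc j))" "q \<notin> FA"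
      "q \<in> CPre H (W (Suc i) (Suc j)) (Y (Suc i) - FA)"
proof -
  obtain i j where r: "rk q = (Suc i, Suc j)"
    "q \<in> Y (Suc i)" "q \<notin> Y i" "q \<in> W (Suc i) (Suc j)" "q \<notin> W (Suc i) j"
    using rank_exists[OF assms] .
  have W1: "q \<in> W (Suc i') 1" if "q \<in> FG \<inter> Pre_sys H Z \<or> q \<in> Pre_sys H (Y i')" for i'
    using that by (auto simp: W_iter.simps(2) \<Phi>_def body_def)
  have j0: "j = 0" if "q \<in> W (Suc i) 1"
    using that r(5) W_mono[of 1 j i] by (cases j) auto
  consider "q \<in> FG \<inter> Pre_sys H Z" | "q \<in> Pre_sys H (Y i)"
    | "q \<notin> FA" "q \<in> CPre H (W (Suc i) j) (Y (Suc i) - FA)"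
    using r(4) by (auto simp: W_iter.simps(2) \<Phi>_def body_def)
  then show thesis
  proof cases
    case 1
    have "q \<in> Y 1"
      using rank_less_W(2)[of q 0 1] W1[of 0] 1 by simp
    then have "i = 0"
      using r(3) Y_mono[of 1 i] by (cases i) (auto)
    then show thesis
      using recurrent 1 r(1) j0 W1[of i] by auto
  next
    case 2
    then show thesis
      using progress r(1) j0 W1[of i] by auto
  next
    case 3
    then have "j \<noteq> 0"
      by (cases j) (auto simp: CPre_def Pre_ex_def)
    then show thesis
      using avoid 3 r(1) by (cases j) auto
  qed
qed

lemma env_sys_disjoint: "q \<in> env_states H \<Longrightarrow> q \<notin> sys_states H"
  using game by (auto simp: game_graph_def)

end

section \<open>The strategy\<close>

locale rank_strategy = ranked_game H FA FG
  for H :: "'q game_graph" and FA FG :: "'q set" +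
  fixes f :: "'q list \<Rightarrow> 'q"
  assumes f_memoryless: "memoryless H f"
    and f_move: "\<And>q. q \<in> sys_states H \<Longrightarrow> q \<in> Z \<Longrightarrow> f [q] \<in> sys_trans H q"
    and f_Z: "\<And>q. q \<in> sys_states H \<Longrightarrow> q \<in> Z \<Longrightarrow> f [q] \<in> Z"
    and f_rank: "\<And>q. q \<in> sys_states H \<Longrightarrow> q \<in> Z \<Longrightarrow> rank_less (1, 1) (rk q) \<Longrightarrow>
      rank_less (rk (f [q])) (rk q)"
begin

definition step :: "'q \<Rightarrow> 'q \<Rightarrow> bool" where
  "step q p \<longleftrightarrow> move H q p \<and> (q \<in> sys_states H \<longrightarrow> p = f [q])"

lemma move_states: "move H q p \<Longrightarrow> q \<in> states H"
  by (auto simp: move_def states_def)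

lemma strategy_plays_iff:
  "\<pi> \<in> strategy_plays H f q \<longleftrightarrow> \<pi> 0 = q \<and> (\<forall>k. step (\<pi> k) (\<pi> (Suc k)))"
proof -
  have "f (prefix_of \<pi> (Suc k)) = f [\<pi> k]"
    if m: "\<forall>k. move H (\<pi> k) (\<pi> (Suc k))" and "\<pi> k \<in> sys_states H" for k
  proof -
    have "prefix_of \<pi> (Suc k) \<in> sys_histories H"
      using that move_states[OF m[rule_format]]
      by (auto simp: sys_histories_def prefix_of_def last_map simp del: upt_Suc)
    moreover have "[\<pi> k] \<in> sys_histories H"
      using that by (auto simp: sys_histories_def states_def)
    moreover have "last (prefix_of \<pi> (Suc k)) = last [\<pi> k]"
      by (simp add: prefix_of_def)
    ultimately show ?thesis
      using f_memoryless unfolding memoryless_def by blast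
  qed
  then show ?thesis
    using move_states
    by (auto simp: strategy_plays_def plays_def state_sequences_def step_def)
qed

lemma step_rank:
  assumes q: "q \<in> Z" and s: "step q p"
  shows "p \<in> Z"
    and "q \<notin> FG \<Longrightarrow> fst (rk p) \<le> fst (rk q)"
    and "q \<notin> FG \<Longrightarrow> q \<in> FA \<Longrightarrow> fst (rk p) < fst (rk q)"
proof -
  have "p \<in> Z \<and> (q \<notin> FG \<longrightarrow> fst (rk p) \<le> fst (rk q) \<and> (q \<in> FA \<longrightarrow> fst (rk p) < fst (rk q)))"
  proof (cases "q \<in> sys_states H")
    case True
    then have p: "p = f [q]" "p \<in> Z"
      using s f_Z q by (auto simp: step_def)
    have "q \<notin> env_states H"
      using True env_sys_disjoint by blast
    obtain i j where rp: "rk p = (Suc i, Suc j)"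
      using rank_exists[OF p(2)] .
    from q show ?thesis
    proof (cases rule: rank_cases)
      case (progress k)
      then have "k \<noteq> 0"
        using True \<open>q \<notin> env_states H\<close> by (auto simp: Pre_sys_def)
      then have "rank_less (rk p) (rk q)"
        using f_rank[OF True q] progress(1) p(1) by (simp add: rank_less_def)
      then show ?thesis
        using progress(1) p(2) rp by (auto simp: rank_less_def)
    next
      case (avoid k l)
      then have "rank_less (rk p) (rk q)"
        using f_rank[OF True q] p(1) by (cases k) (simp_all add: rank_less_def)
      then show ?thesis
        using avoid p(2) rp by (auto simp: rank_less_def)
    qed (use p(2) in simp)
  next
    case False
    then have e: "q \<in> env_states H" "p \<in> env_trans H q"
      using s by (auto simp: step_def move_def)
    from q show ?thesis
    proof (cases rule: rank_cases)
      case recurrent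
      then show ?thesis using e False by (auto simp: Pre_sys_def)
    next
      case (progress k)
      then have "p \<in> Y k" using e False by (auto simp: Pre_sys_def)
      then show ?thesis
        using fst_rank_le[of p k] Y_subset_Z[of k] progress(1) by auto
    next
      case (avoid k l)
      then have "p \<in> W (Suc k) (Suc l) \<union> Y (Suc k)"
        using e False by (auto simp: CPre_def Pre_sys_def)
      then have "p \<in> Y (Suc k)"
        using rank_less_W(2)[of p k "Suc l"] by blast
      then show ?thesis
        using fst_rank_le[of p "Suc k"] Y_subset_Z[of "Suc k"] avoid by auto
    qed
  qed
  then show "p \<in> Z"
    and "q \<notin> FG \<Longrightarrow> fst (rk p) \<le> fst (rk q)"
    and "q \<notin> FG \<Longrightarrow> q \<in> FA \<Longrightarrow> fst (rk p) < fst (rk q)"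
    by auto
qed

lemma strategy_play_in_Z:
  assumes "q \<in> Z" "\<pi> \<in> strategy_plays H f q"
  shows "\<pi> k \<in> Z"
  using assms by (induction k) (auto simp: strategy_plays_iff intro: step_rank(1))

lemma infinite_FA_imp_infinite_FG:
  assumes "q \<in> Z" "\<pi> \<in> strategy_plays H f q" "infinite {k. \<pi> k \<in> FA}"
  shows "infinite {k. \<pi> k \<in> FG}"
proof
  assume "finite {k. \<pi> k \<in> FG}"
  then obtain N where N: "\<And>k. k \<ge> N \<Longrightarrow> \<pi> k \<notin> FG"
    unfolding finite_nat_set_iff_bounded by (metis mem_Collect_eq not_le)
  define r where "r k = fst (rk (\<pi> k))" for k
  have Z: "\<pi> k \<in> Z" and s: "step (\<pi> k) (\<pi> (Suc k))" for k
    using strategy_play_in_Z[OF assms(1,2)] assms(2) by (auto simp: strategy_plays_iff)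
  obtain M where M: "M \<ge> N" "\<And>k. k \<ge> N \<Longrightarrow> r M \<le> r k"
    using ex_has_least_nat[of "\<lambda>k. k \<ge> N" N r] by auto
  have const: "r k \<le> r M" if "k \<ge> M" for k
    using that
  proof (induction k rule: dec_induct)
    case (step k)
    then show ?case
      using step_rank(2)[OF Z s, of k] N[of k] M(1) unfolding r_def by linarith
  qed simp
  have "\<pi> k \<notin> FA" if "k \<ge> M" for k
    using step_rank(3)[OF Z s, of k] N[of k] M(1) M(2)[of "Suc k"] const[OF that] that
    unfolding r_def by fastforce
  then have "{k. \<pi> k \<in> FA} \<subseteq> {..<M}"
    by (auto simp: not_less[symmetric])
  then show False
    using assms(3) finite_subset by blast
qed

lemma cooperative_step:
  assumes nb: "env_nonblocking H" and q: "q \<in> Z"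
  shows "\<exists>p. step q p \<and> p \<in> Z \<and> (q \<in> FG \<or> rank_less (rk p) (rk q))"
proof (cases "q \<in> sys_states H")
  case True
  then have s: "step q (f [q])"
    using f_move[OF True q] by (simp add: step_def move_def)
  have "q \<in> FG \<or> rank_less (1, 1) (rk q)"
    using q
  proof (cases rule: rank_cases)
    case (progress i)
    then have "i \<noteq> 0"
      using True env_sys_disjoint[of q] by (auto simp: Pre_sys_def)
    then show ?thesis using progress by (simp add: rank_less_def)
  next
    case (avoid i j)
    then show ?thesis by (cases i) (simp_all add: rank_less_def)
  qed simp
  then show ?thesis
    using s f_Z[OF True q] f_rank[OF True q] by blast
next
  case False
  then have e: "q \<in> env_states H"
    using q Z_subset_states by (auto simp: states_def)
  have step: "step q p" if "p \<in> env_trans H q" for p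
    using that e False by (auto simp: step_def move_def)
  obtain p where p: "p \<in> env_trans H q"
    using nb e by (auto simp: env_nonblocking_def)
  from q show ?thesis
  proof (cases rule: rank_cases)
    case recurrent
    then show ?thesis using step[OF p] step_rank(1)[OF q] by blast
  next
    case (progress i)
    then have "p \<in> Y i" using p e False by (auto simp: Pre_sys_def)
    then have "rank_less (rk p) (rk q)"
      using fst_rank_le[of p i] progress(1) by (cases "rk p") (auto simp: rank_less_def)
    then show ?thesis using step[OF p] step_rank(1)[OF q] by blast
  next
    case (avoid i j)
    then obtain p' where p': "p' \<in> env_trans H q" "p' \<in> W (Suc i) (Suc j)"
      using e False by (auto simp: CPre_def Pre_ex_def)
    then show ?thesis
      using rank_less_W(1)[OF p'(2)] step[OF p'(1)] step_rank(1)[OF q] avoid(1) by auto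
  qed
qed

lemma wf_rank_less: "wfp rank_less"
  unfolding rank_less_def wfp_def using wf_lex_prod[OF wf_less_than wf_less_than] by simp

lemma cooperative_play:
  assumes nb: "env_nonblocking H" and q: "q \<in> Z"
  shows "\<exists>\<pi> \<in> strategy_plays H f q. infinite {k. \<pi> k \<in> FG}"
proof -
  obtain g where g: "step x (g x)" "g x \<in> Z" "x \<in> FG \<or> rank_less (rk (g x)) (rk x)"
    if "x \<in> Z" for x
    using cooperative_step[OF nb] by metis
  define \<pi> where "\<pi> k = (g ^^ k) q" for k
  have Z: "\<pi> k \<in> Z" for k
    unfolding \<pi>_def by (induction k) (auto simp: q g(2))
  have Suc: "\<pi> (Suc k) = g (\<pi> k)" for k
    by (simp add: \<pi>_def)
  have "\<pi> \<in> strategy_plays H f q"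
    unfolding strategy_plays_iff using g(1)[OF Z] by (simp add: Suc) (simp add: \<pi>_def)
  moreover have "\<exists>m\<ge>n. \<pi> m \<in> FG" for n
  proof (induction "rk (\<pi> n)" arbitrary: n rule: wfp_induct_rule[OF wf_rank_less])
    case 1
    show ?case
    proof (cases "\<pi> n \<in> FG")
      case False
      then have "\<exists>m\<ge>Suc n. \<pi> m \<in> FG"
        using g(3)[OF Z[of n]] 1[of "Suc n"] by (simp add: Suc)
      then show ?thesis using Suc_leD by blast
    qed auto
  qed
  ultimately show ?thesis
    unfolding finite_nat_set_iff_bounded by (metis mem_Collect_eq not_le)
qed

lemma cooperative_extension:
  assumes nb: "env_nonblocking H" and q: "q \<in> Z" and \<pi>: "\<pi> \<in> strategy_plays H f q"
  shows "\<exists>\<pi>' \<in> strategy_plays H f q. prefix_of \<pi>' n = prefix_of \<pi> n \<and> infinite {k. \<pi>' k \<in> FG}"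
proof -
  obtain \<sigma> where \<sigma>: "\<sigma> \<in> strategy_plays H f (\<pi> n)" "infinite {k. \<sigma> k \<in> FG}"
    using cooperative_play[OF nb strategy_play_in_Z[OF q \<pi>]] by blast
  define \<pi>' where "\<pi>' k = (if k < n then \<pi> k else \<sigma> (k - n))" for k
  have "step (\<pi>' k) (\<pi>' (Suc k))" for k
  proof -
    consider "Suc k < n" | "Suc k = n" | "n \<le> k" by linarith
    then show ?thesis
    proof cases
      case 2
      then have "\<pi>' (Suc k) = \<pi> (Suc k)"
        using \<sigma>(1) by (simp add: \<pi>'_def strategy_plays_iff)
      then show ?thesis
        using \<pi> 2 by (auto simp: \<pi>'_def strategy_plays_iff)
    qed (use \<pi> \<sigma>(1) in \<open>auto simp: \<pi>'_def strategy_plays_iff Suc_diff_le\<close>)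
  qed
  moreover have "\<pi>' 0 = q"
    using \<pi> \<sigma>(1) by (auto simp: \<pi>'_def strategy_plays_iff)
  ultimately have "\<pi>' \<in> strategy_plays H f q"
    by (simp add: strategy_plays_iff)
  moreover have "prefix_of \<pi>' n = prefix_of \<pi> n"
    by (simp add: prefix_of_def \<pi>'_def)
  moreover have "infinite {k. \<pi>' k \<in> FG}"
  proof
    assume "finite {k. \<pi>' k \<in> FG}"
    then have "finite ((\<lambda>k. k + n) -` {k. \<pi>' k \<in> FG})"
      by (rule finite_vimageI) simp
    then show False
      using \<sigma>(2) by (simp add: vimage_def \<pi>'_def)
  qed
  ultimately show ?thesis by blast
qed

end

theorem theorem1:
  fixes H :: "'q game_graph" and FA FG :: "'q set" and f :: "'q list \<Rightarrow> 'q"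
  assumes "game_graph H"
    and "FA \<subseteq> states H" and "FG \<subseteq> states H"
    and "sys_strategy H f" and "memoryless H f"
    and "\<forall>q \<in> sys_states H \<inter> Z_inf H FA FG.
           f [q] \<in> sys_trans H q \<and>
           (if rank_less (1, 1) (rank H FA FG q)
            then f [q] \<in> Z_inf H FA FG \<and> rank_less (rank H FA FG (f [q])) (rank H FA FG q)
            else f [q] \<in> Z_inf H FA FG)"
  shows "\<forall>q \<in> Z_inf H FA FG.
           strategy_plays H f q \<subseteq> (state_sequences H - buechi_plays H {FA} q) \<union> buechi_plays H {FG} q \<and>
           (env_nonblocking H \<longrightarrow>
              strategy_plays H f q \<inter> buechi_plays H {FG} q \<noteq> {} \<and>
              (buechi_plays H {FG} q \<subseteq> buechi_plays H {FA} q \<longrightarrow>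
                 pre (strategy_plays H f q) = pre (strategy_plays H f q \<inter> buechi_plays H {FA} q)))"
proof
  fix q assume q: "q \<in> Z_inf H FA FG"
  interpret rank_strategy H FA FG f
    using assms(1,5,6) by unfold_locales (auto split: if_splits)
  have plays: "\<pi> \<in> plays H q" if "\<pi> \<in> strategy_plays H f q" for \<pi>
    using that by (simp add: strategy_plays_def)
  have "strategy_plays H f q \<subseteq> (state_sequences H - buechi_plays H {FA} q) \<union> buechi_plays H {FG} q"
    using infinite_FA_imp_infinite_FG[OF q] plays by (auto simp: buechi_plays_def plays_def)
  moreover have "strategy_plays H f q \<inter> buechi_plays H {FG} q \<noteq> {}" if "env_nonblocking H"
    using cooperative_play[OF that q] plays by (auto simp: buechi_plays_def)
  moreover have "pre (strategy_plays H f q) = pre (strategy_plays H f q \<inter> buechi_plays H {FA} q)"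
    if nb: "env_nonblocking H" and sub: "buechi_plays H {FG} q \<subseteq> buechi_plays H {FA} q"
  proof
    show "pre (strategy_plays H f q) \<subseteq> pre (strategy_plays H f q \<inter> buechi_plays H {FA} q)"
    proof
      fix w assume "w \<in> pre (strategy_plays H f q)"
      then obtain \<pi> n where w: "w = prefix_of \<pi> n" and \<pi>: "\<pi> \<in> strategy_plays H f q"
        by (auto simp: pre_def)
      obtain \<pi>' where \<pi>': "\<pi>' \<in> strategy_plays H f q" "prefix_of \<pi>' n = prefix_of \<pi> n"
        "infinite {k. \<pi>' k \<in> FG}"
        using cooperative_extension[OF nb q \<pi>] by blast
      then have "\<pi>' \<in> buechi_plays H {FA} q"
        using sub plays by (auto simp: buechi_plays_def)
      then show "w \<in> pre (strategy_plays H f q \<inter> buechi_plays H {FA} q)"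
        using \<pi>'(1,2) w by (auto simp: pre_def intro!: exI[of _ \<pi>'] exI[of _ n])
    qed
  qed (auto simp: pre_def)
  ultimately show
    "strategy_plays H f q \<subseteq> (state_sequences H - buechi_plays H {FA} q) \<union> buechi_plays H {FG} q \<and>
     (env_nonblocking H \<longrightarrow>
        strategy_plays H f q \<inter> buechi_plays H {FG} q \<noteq> {} \<and>
        (buechi_plays H {FG} q \<subseteq> buechi_plays H {FA} q \<longrightarrow>
           pre (strategy_plays H f q) = pre (strategy_plays H f q \<inter> buechi_plays H {FA} q)))"
    by blast
qed

end
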